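(* Let $\Bbbk$ be an algebraically closed field of characteristic zero and $\Lambda_2(\Bbbk)=\Bbbk\langle x,y:yx=xy+y^2\rangle$ the Jordanian plane. Let $p(y)\in\Bbbk[y]$ and let $\delta_p$ be the locally nilpotent derivation of $\Lambda_2(\Bbbk)$ defined by $\delta_p(y)=0$ and $\delta_p(x)=p(y)$. Then $$\mathrm{Aut}_{\delta_p}(\Lambda_2(\Bbbk))=\{\varphi_{\gamma,g}\in\mathrm{Aut}(\Lambda_2(\Bbbk)) : p(\gamma y)=\gamma p(y)\}.$$
   Context: For $\gamma\in\Bbbk^*$ and $g(y)\in\Bbbk[y]$, $\varphi_{\gamma,g}$ denotes the $\Bbbk$-algebra automorphism of $\Lambda_2(\Bbbk)$ with $\varphi_{\gamma,g}(x)=\gamma x+g(y)$, $\varphi_{\gamma,g}(y)=\gamma y$; known fact: every automorphism of $\Lambda_2(\Bbbk)$ is of this form. For a derivation $\delta$, the isotropy group is $\mathrm{Aut}_\delta(\Lambda_2(\Bbbk))=\{\rho\in\mathrm{Aut}(\Lambda_2(\Bbbk)):\rho\delta=\delta\rho\}$. *)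

theory Defs
  imports "HOL-Library.Poly_Mapping" "HOL-Computational_Algebra.Polynomial"
begin

text \<open>The free monoid is a type of its own, because \<open>poly_mapping\<close> needs concatenation to be
  the \<open>+\<close> of \<open>monoid_add\<close>: the (convolution) product of \<open>word \<Rightarrow>\<^sub>0 'k\<close> is then that of the
  free algebra \<open>k\<langle>x, y\<rangle>\<close>.\<close>

datatype letter = LX | LY

datatype word = Word (letters: "letter list")

instantiation word :: monoid_add
begin

definition zero_word :: word where "0 = Word []"

fun plus_word :: "word \<Rightarrow> word \<Rightarrow> word" where
  "Word u + Word v = Word (u @ v)"

instance
proof
  fix a b c :: word
  show "a + b + c = a + (b + c)" by (cases a; cases b; cases c) simp
  show "0 + a = a" by (cases a) (simp add: zero_word_def)
  show "a + 0 = a" by (cases a) (simp add: zero_word_def)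
qed

end

lemma letters_plus [simp]: "letters (u + v) = letters u @ letters v"
  by (cases u; cases v) simp

lemma letters_zero [simp]: "letters 0 = []"
  by (simp add: zero_word_def)

type_synonym 'k free2 = "word \<Rightarrow>\<^sub>0 'k"

definition free_const :: "'k \<Rightarrow> 'k::field free2" where
  "free_const c = Poly_Mapping.single 0 c"

definition free_gen :: "letter \<Rightarrow> 'k::field free2" where
  "free_gen l = Poly_Mapping.single (Word [l]) 1"

lemma free_const_central: "free_const c * f = f * free_const (c :: 'k::field)"
proof (induction f rule: update_induct)
  case const
  show ?case by simp
next
  case (update f a b)
  have "Poly_Mapping.update a b f = Poly_Mapping.single a b + f"
    using update(1)
    by (intro poly_mapping_eqI)
      (auto simp: lookup_update lookup_add lookup_single in_keys_iff when_def)
  then show ?case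
    using update(3) by (simp add: algebra_simps free_const_def mult_single)
qed

lemma free_induct [case_names single add]:
  fixes f :: "'k::field free2"
  assumes "\<And>w c. P (Poly_Mapping.single w c)"
    and "\<And>f g. P f \<Longrightarrow> P g \<Longrightarrow> P (f + g)"
  shows "P f"
proof (induction f rule: update_induct)
  case const
  show ?case using assms(1)[of 0 0] by simp
next
  case (update f a b)
  have "Poly_Mapping.update a b f = Poly_Mapping.single a b + f"
    using update(1)
    by (intro poly_mapping_eqI)
      (auto simp: lookup_update lookup_add lookup_single in_keys_iff when_def)
  then show ?case using update(3) assms by simp
qed

definition jordan_relator :: "'k::field free2" where
  "jordan_relator = free_gen LY * free_gen LX
     - (free_gen LX * free_gen LY + free_gen LY * free_gen LY)"

inductive_set jordan_ideal :: "'k::field free2 set" where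
  zero: "0 \<in> jordan_ideal"
| relator: "jordan_relator \<in> jordan_ideal"
| add: "f \<in> jordan_ideal \<Longrightarrow> g \<in> jordan_ideal \<Longrightarrow> f + g \<in> jordan_ideal"
| mult_left: "f \<in> jordan_ideal \<Longrightarrow> a * f \<in> jordan_ideal"
| mult_right: "f \<in> jordan_ideal \<Longrightarrow> f * a \<in> jordan_ideal"

lemma jordan_ideal_uminus: "f \<in> jordan_ideal \<Longrightarrow> - f \<in> jordan_ideal"
  using jordan_ideal.mult_left[of f "-1"] by simp

definition jordan_rel :: "'k::field free2 \<Rightarrow> 'k free2 \<Rightarrow> bool" where
  "jordan_rel f g \<longleftrightarrow> f - g \<in> jordan_ideal"

lemma equivp_jordan_rel: "equivp jordan_rel"
proof (rule equivpI)
  show "reflp jordan_rel"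
    by (simp add: reflp_def jordan_rel_def jordan_ideal.zero)
  show "symp jordan_rel"
    by (rule sympI) (metis jordan_rel_def jordan_ideal_uminus minus_diff_eq)
  show "transp jordan_rel"
  proof (rule transpI)
    fix f g h :: "'k::field free2"
    assume "jordan_rel f g" "jordan_rel g h"
    then have "(f - g) + (g - h) \<in> jordan_ideal"
      unfolding jordan_rel_def by (rule jordan_ideal.add)
    then show "jordan_rel f h" by (simp add: jordan_rel_def)
  qed
qed

quotient_type (overloaded) 'k jordan = "'k::field free2" / jordan_rel
  by (rule equivp_jordan_rel)

lemma jordan_rel_add:
  "jordan_rel f f' \<Longrightarrow> jordan_rel g g' \<Longrightarrow> jordan_rel (f + g) (f' + g')"
  unfolding jordan_rel_def by (metis add_diff_add jordan_ideal.add)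

lemma jordan_rel_uminus: "jordan_rel f f' \<Longrightarrow> jordan_rel (- f) (- f')"
  unfolding jordan_rel_def using jordan_ideal_uminus by fastforce

lemma jordan_rel_mult:
  assumes "jordan_rel f f'" "jordan_rel g g'"
  shows "jordan_rel (f * g) (f' * g')"
proof -
  have "(f - f') * g + f' * (g - g') \<in> jordan_ideal"
    using assms unfolding jordan_rel_def by (intro jordan_ideal.intros)
  then show ?thesis by (simp add: jordan_rel_def algebra_simps)
qed

lemma lookup_mult_zero_word:
  "Poly_Mapping.lookup (f * g) 0 = Poly_Mapping.lookup f 0 * Poly_Mapping.lookup g 0"
  for f g :: "'k::field free2"
proof -
  have sum0: "u + v = 0 \<longleftrightarrow> u = 0 \<and> v = 0" for u v :: word
    by (cases u; cases v) (simp add: zero_word_def)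
  show ?thesis
  proof (induction f rule: free_induct)
    case (single w c)
    show ?case
    proof (induction g rule: free_induct)
      case (single v d)
      show ?case by (auto simp: mult_single lookup_single when_def sum0)
    qed (simp add: algebra_simps lookup_add)
  qed (simp add: algebra_simps lookup_add)
qed

lemma lookup_jordan_ideal:
  "f \<in> jordan_ideal \<Longrightarrow> Poly_Mapping.lookup f 0 = 0"
  by (induction rule: jordan_ideal.induct)
    (simp_all add: lookup_add lookup_minus lookup_mult_zero_word jordan_relator_def
      free_gen_def lookup_single when_def, simp_all add: zero_word_def)

instantiation jordan :: (field) ring_1
begin

lift_definition zero_jordan :: "'a jordan" is 0 .
lift_definition one_jordan :: "'a jordan" is 1 .
lift_definition plus_jordan :: "'a jordan \<Rightarrow> 'a jordan \<Rightarrow> 'a jordan" is "(+)"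
  by (rule jordan_rel_add)
lift_definition uminus_jordan :: "'a jordan \<Rightarrow> 'a jordan" is uminus
  by (rule jordan_rel_uminus)
lift_definition minus_jordan :: "'a jordan \<Rightarrow> 'a jordan \<Rightarrow> 'a jordan" is "(-)"
  using jordan_rel_add[OF _ jordan_rel_uminus] by fastforce
lift_definition times_jordan :: "'a jordan \<Rightarrow> 'a jordan \<Rightarrow> 'a jordan" is "(*)"
  by (rule jordan_rel_mult)

instance
proof
  have refl: "jordan_rel f f" for f :: "'a free2"
    by (simp add: jordan_rel_def jordan_ideal.zero)
  fix a b c :: "'a jordan"
  show "a * b * c = a * (b * c)" by transfer (simp add: refl mult.assoc)
  show "1 * a = a" by transfer (simp add: refl)
  show "a * 1 = a" by transfer (simp add: refl)
  show "a + b + c = a + (b + c)" by transfer (simp add: refl add.assoc)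
  show "a + b = b + a" by transfer (simp add: refl add.commute)
  show "0 + a = a" by transfer (simp add: refl)
  show "- a + a = 0" by transfer (simp add: refl)
  show "a - b = a + - b" by transfer (simp add: refl)
  show "(a + b) * c = a * c + b * c" by transfer (simp add: refl distrib_right)
  show "a * (b + c) = a * b + a * c" by transfer (simp add: refl distrib_left)
  show "(0 :: 'a jordan) \<noteq> 1"
  proof (transfer, rule notI)
    assume "jordan_rel (0 :: 'a free2) 1"
    then have "Poly_Mapping.lookup (0 - 1 :: 'a free2) 0 = 0"
      unfolding jordan_rel_def by (rule lookup_jordan_ideal)
    then show False by (simp add: lookup_minus)
  qed
qed

end

lift_definition jscale :: "'k::field \<Rightarrow> 'k jordan \<Rightarrow> 'k jordan" is "\<lambda>c f. free_const c * f"
  by (rule jordan_rel_mult) (simp_all add: jordan_rel_def jordan_ideal.zero)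

lift_definition jX :: "'k::field jordan" is "free_gen LX" .

lift_definition jY :: "'k::field jordan" is "free_gen LY" .

lemma jordan_relation: "jY * jX = jX * jY + (jY ^ 2 :: 'k::field jordan)"
proof -
  have "jY * jX = jX * jY + jY * (jY :: 'k jordan)"
    by transfer (use jordan_ideal.relator in \<open>simp add: jordan_rel_def jordan_relator_def\<close>)
  then show ?thesis by (simp add: power2_eq_square)
qed

interpretation jordan: vector_space "jscale :: 'k::field \<Rightarrow> 'k jordan \<Rightarrow> 'k jordan"
proof
  have refl: "jordan_rel f f" for f :: "'k free2"
    by (simp add: jordan_rel_def jordan_ideal.zero)
  fix a b :: 'k and u v :: "'k jordan"
  show "jscale a (u + v) = jscale a u + jscale a v"
    by transfer (simp add: refl distrib_left)
  show "jscale (a + b) u = jscale a u + jscale b u"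
    by transfer (simp add: refl distrib_right free_const_def single_add)
  show "jscale a (jscale b u) = jscale (a * b) u"
    by transfer (simp add: refl free_const_def mult_single flip: mult.assoc)
  show "jscale 1 u = u"
    by transfer (simp add: refl free_const_def)
qed

lemma jscale_mult_left: "jscale c u * v = jscale c (u * v)"
  by transfer (simp add: mult.assoc jordan_rel_def jordan_ideal.zero)

lemma jscale_mult_right: "u * jscale c v = jscale c (u * v)"
  by transfer
    (metis (no_types, lifting) equivp_jordan_rel equivp_reflp free_const_central mult.assoc)

definition alg_endo :: "('k::field jordan \<Rightarrow> 'k jordan) \<Rightarrow> bool" where
  "alg_endo \<rho> \<longleftrightarrow> Vector_Spaces.linear jscale jscale \<rho> \<and> \<rho> 1 = 1 \<and> (\<forall>u v. \<rho> (u * v) = \<rho> u * \<rho> v)"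

definition Aut :: "('k::field jordan \<Rightarrow> 'k jordan) set" where
  "Aut = {\<rho>. alg_endo \<rho> \<and> bij \<rho>}"

definition derivation :: "('k::field jordan \<Rightarrow> 'k jordan) \<Rightarrow> bool" where
  "derivation \<delta> \<longleftrightarrow> Vector_Spaces.linear jscale jscale \<delta> \<and> (\<forall>u v. \<delta> (u * v) = \<delta> u * v + u * \<delta> v)"

definition locally_nilpotent :: "('k::field jordan \<Rightarrow> 'k jordan) \<Rightarrow> bool" where
  "locally_nilpotent \<delta> \<longleftrightarrow> (\<forall>u. \<exists>n. (\<delta> ^^ n) u = 0)"

definition isotropy :: "('k::field jordan \<Rightarrow> 'k jordan) \<Rightarrow> ('k jordan \<Rightarrow> 'k jordan) set" where
  "isotropy \<delta> = {\<rho> \<in> Aut. \<rho> \<circ> \<delta> = \<delta> \<circ> \<rho>}"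

text \<open>The library's \<open>poly\<close> evaluates in the (commutative) coefficient ring only.\<close>

definition jeval :: "'k::field poly \<Rightarrow> 'k jordan \<Rightarrow> 'k jordan" where
  "jeval g u = (\<Sum>i\<le>degree g. jscale (coeff g i) (u ^ i))"

text \<open>Both definite descriptions below denote: see \<open>phi\<close>, \<open>phi_in_Aut\<close>, \<open>delta\<close> and
  \<open>locally_nilpotent_delta\<close>.\<close>

definition phi :: "'k::field \<Rightarrow> 'k poly \<Rightarrow> 'k jordan \<Rightarrow> 'k jordan" where
  "phi \<gamma> g = (THE \<rho>. alg_endo \<rho> \<and> \<rho> jX = jscale \<gamma> jX + jeval g jY \<and> \<rho> jY = jscale \<gamma> jY)"

definition delta :: "'k::field poly \<Rightarrow> 'k jordan \<Rightarrow> 'k jordan" where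
  "delta p = (THE \<delta>. derivation \<delta> \<and> \<delta> jY = 0 \<and> \<delta> jX = jeval p jY)"

lemma alg_endoD:
  assumes "alg_endo \<rho>"
  shows "\<rho> (u + v) = \<rho> u + \<rho> v" "\<rho> (jscale c u) = jscale c (\<rho> u)"
    "\<rho> 1 = 1" "\<rho> (u * v) = \<rho> u * \<rho> v" "\<rho> 0 = 0" "\<rho> (u - v) = \<rho> u - \<rho> v"
    "\<rho> (sum F S) = (\<Sum>s\<in>S. \<rho> (F s))" "\<rho> (u ^ n) = \<rho> u ^ n"
proof -
  interpret l: Vector_Spaces.linear jscale jscale \<rho>
    using assms by (simp add: alg_endo_def)
  show "\<rho> (u + v) = \<rho> u + \<rho> v" "\<rho> (jscale c u) = jscale c (\<rho> u)"
    "\<rho> 0 = 0" "\<rho> (u - v) = \<rho> u - \<rho> v" "\<rho> (sum F S) = (\<Sum>s\<in>S. \<rho> (F s))"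
    by (simp_all add: l.add l.scale l.diff l.sum)
  show one: "\<rho> 1 = 1" and mult: "\<rho> (u * v) = \<rho> u * \<rho> v" for u v
    using assms by (simp_all add: alg_endo_def)
  show "\<rho> (u ^ n) = \<rho> u ^ n"
    by (induction n) (simp_all add: one mult)
qed

lemma derivationD:
  assumes "derivation \<delta>"
  shows "\<delta> (u + v) = \<delta> u + \<delta> v" "\<delta> (jscale c u) = jscale c (\<delta> u)"
    "\<delta> (u * v) = \<delta> u * v + u * \<delta> v" "\<delta> 0 = 0" "\<delta> 1 = 0"
    "\<delta> (sum F S) = (\<Sum>s\<in>S. \<delta> (F s))"
proof -
  interpret l: Vector_Spaces.linear jscale jscale \<delta>
    using assms by (simp add: derivation_def)
  show "\<delta> (u + v) = \<delta> u + \<delta> v" "\<delta> (jscale c u) = jscale c (\<delta> u)" "\<delta> 0 = 0"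
    "\<delta> (sum F S) = (\<Sum>s\<in>S. \<delta> (F s))"
    by (simp_all add: l.add l.scale l.sum)
  show leibniz: "\<delta> (u * v) = \<delta> u * v + u * \<delta> v" for u v
    using assms by (simp add: derivation_def)
  show "\<delta> 1 = 0"
    using leibniz[of 1 1] by simp
qed

definition jproj :: "'k::field free2 \<Rightarrow> 'k jordan" where
  "jproj = abs_jordan"

lemma jproj_add: "jproj (f + g) = jproj f + jproj g"
  and jproj_mult: "jproj (f * g) = jproj f * jproj g"
  and jproj_0: "jproj 0 = 0"
  and jproj_1: "jproj 1 = 1"
  and jproj_const: "jproj (free_const c * f) = jscale c (jproj f)"
  and jproj_gen: "jproj (free_gen LX) = jX" "jproj (free_gen LY) = jY"
  by (simp_all add: jproj_def plus_jordan.abs_eq times_jordan.abs_eq zero_jordan.abs_eq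
      one_jordan.abs_eq jscale.abs_eq jX.abs_eq jY.abs_eq)

lemma jproj_surj: "\<exists>f. u = jproj f"
  unfolding jproj_def by (metis Quotient3_abs_rep Quotient3_jordan)

lemma single_Word_Cons:
  "Poly_Mapping.single (Word (l # w)) c = free_gen l * Poly_Mapping.single (Word w) (c :: 'k::field)"
  by (simp add: free_gen_def mult_single)

lemma single_Word_Nil:
  "Poly_Mapping.single (Word []) c = free_const (c :: 'k::field) * 1"
  by (simp add: free_const_def zero_word_def)

lemma jordan_induct [case_names one X Y scale add mult]:
  assumes "P 1" "P jX" "P jY" "\<And>c u. P u \<Longrightarrow> P (jscale c u)"
    "\<And>u v. P u \<Longrightarrow> P v \<Longrightarrow> P (u + v)" "\<And>u v. P u \<Longrightarrow> P v \<Longrightarrow> P (u * v)"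
  shows "P (u :: 'k::field jordan)"
proof -
  have "P (jproj f)" for f :: "'k free2"
  proof (induction f rule: free_induct)
    case (single w c)
    have "P (jproj (Poly_Mapping.single (Word ls) c))" for ls
    proof (induction ls)
      case Nil
      show ?case
        unfolding single_Word_Nil jproj_const jproj_1 by (intro assms)
    next
      case (Cons l ls)
      then show ?case
        unfolding single_Word_Cons jproj_mult by (cases l) (auto simp: jproj_gen intro: assms)
    qed
    from this[of "letters w"] show ?case by simp
  qed (simp add: jproj_add assms)
  then show ?thesis using jproj_surj by metis
qed

lemma alg_endo_eqI:
  assumes "alg_endo \<rho>" "alg_endo \<sigma>" "\<rho> jX = \<sigma> jX" "\<rho> jY = \<sigma> jY"
  shows "\<rho> = \<sigma>"
proof
  fix u
  show "\<rho> u = \<sigma> u"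
    by (induction u rule: jordan_induct) (simp_all add: assms alg_endoD[OF assms(1)] alg_endoD[OF assms(2)])
qed

lemma derivation_eqI:
  assumes "derivation \<delta>" "derivation \<epsilon>" "\<delta> jX = \<epsilon> jX" "\<delta> jY = \<epsilon> jY"
  shows "\<delta> = \<epsilon>"
proof
  fix u
  show "\<delta> u = \<epsilon> u"
    by (induction u rule: jordan_induct) (simp_all add: assms derivationD[OF assms(1)] derivationD[OF assms(2)])
qed

definition free_ext :: "(word \<Rightarrow> 'k jordan) \<Rightarrow> 'k::field free2 \<Rightarrow> 'k jordan" where
  "free_ext F f = (\<Sum>w\<in>Poly_Mapping.keys f. jscale (Poly_Mapping.lookup f w) (F w))"

lemma free_ext_single: "free_ext F (Poly_Mapping.single w c) = jscale c (F w)"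
  by (simp add: free_ext_def)

lemma free_ext_add: "free_ext F (f + g) = free_ext F f + free_ext F g"
  unfolding free_ext_def
  by (rule setsum_keys_plus_distrib) (simp_all add: jordan.scale_left_distrib)

lemma free_ext_0: "free_ext F 0 = 0"
  by (simp add: free_ext_def)

lemma free_ext_uminus: "free_ext F (- f) = - free_ext F f"
  using free_ext_add[of F f "- f"] by (simp add: free_ext_0 eq_neg_iff_add_eq_0 add.commute)

lemma free_ext_diff: "free_ext F (f - g) = free_ext F f - free_ext F g"
  using free_ext_add[of F f "- g"] by (simp add: free_ext_uminus)

lemma free_ext_const: "free_ext F (free_const c * f) = jscale c (free_ext F f)"
proof (induction f rule: free_induct)
  case (single w d)
  show ?case by (simp add: free_const_def mult_single free_ext_single)
qed (simp add: distrib_left free_ext_add jordan.scale_right_distrib)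

lemma descend:
  fixes F :: "word \<Rightarrow> 'k::field jordan"
  assumes "\<And>f. f \<in> jordan_ideal \<Longrightarrow> free_ext F f = 0"
  obtains h where "Vector_Spaces.linear jscale jscale h" "\<And>f. h (jproj f) = free_ext F f"
proof -
  define h where "h u = free_ext F (rep_jordan u)" for u
  have h: "h (jproj f) = free_ext F f" for f
  proof -
    have "jordan_rel (rep_jordan (jproj f)) f"
      unfolding jproj_def
      by (metis Quotient3_abs_rep Quotient3_jordan jordan.abs_eq_iff)
    then have "free_ext F (rep_jordan (jproj f) - f) = 0"
      by (intro assms) (simp add: jordan_rel_def)
    then show ?thesis by (simp add: h_def free_ext_diff)
  qed
  have "Vector_Spaces.linear jscale jscale h"
  proof
    fix u v :: "'k jordan" and c :: 'k
    obtain f g where "u = jproj f" "v = jproj g" using jproj_surj by metis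
    then show "h (u + v) = h u + h v" "h (jscale c u) = jscale c (h u)"
      by (simp_all add: h free_ext_add free_ext_const flip: jproj_add jproj_const)
  qed
  then show thesis using h that by blast
qed

lemma alg_endo_exists:
  fixes a b :: "'k::field jordan"
  assumes "b * a = a * b + b ^ 2"
  shows "\<exists>\<rho>. alg_endo \<rho> \<and> \<rho> jX = a \<and> \<rho> jY = b"
proof -
  define F where "F w = prod_list (map (\<lambda>l. case l of LX \<Rightarrow> a | LY \<Rightarrow> b) (letters w))" for w
  let ?E = "free_ext F"
  have mult: "?E (f * g) = ?E f * ?E g" for f g
  proof (induction f rule: free_induct)
    case (single w c)
    show ?case
    proof (induction g rule: free_induct)
      case (single v d)
      show ?case
        by (simp add: mult_single free_ext_single F_def jscale_mult_left jscale_mult_right)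
    qed (simp add: algebra_simps free_ext_add)
  qed (simp add: algebra_simps free_ext_add)
  have gen: "?E (free_gen LX) = a" "?E (free_gen LY) = b"
    by (simp_all add: free_gen_def free_ext_single F_def)
  have "?E f = 0" if "f \<in> jordan_ideal" for f
    using that
    by induction (simp_all add: free_ext_0 free_ext_add mult jordan_relator_def free_ext_diff gen
        assms power2_eq_square)
  then obtain h where h: "Vector_Spaces.linear jscale jscale h" "\<And>f. h (jproj f) = ?E f"
    using descend[of F] by blast
  have "h 1 = 1"
    using h(2)[of "Poly_Mapping.single 0 1"] unfolding jproj_1 single_one
    by (simp add: F_def free_ext_single flip: single_one)
  moreover have "h (u * v) = h u * h v" for u v
    using jproj_surj[of u] jproj_surj[of v] by (auto simp: h(2) mult simp flip: jproj_mult)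
  moreover have "h jX = a" "h jY = b"
    using h(2)[of "free_gen LX"] h(2)[of "free_gen LY"] by (simp_all add: gen jproj_gen)
  ultimately show ?thesis using h(1) by (auto simp: alg_endo_def)
qed

lemma derivation_exists:
  fixes a b :: "'k::field jordan"
  assumes "b * jX + jY * a = a * jY + jX * b + b * jY + jY * b"
  shows "\<exists>\<delta>. derivation \<delta> \<and> \<delta> jX = a \<and> \<delta> jY = b"
proof -
  define v where "v l = (case l of LX \<Rightarrow> a | LY \<Rightarrow> b)" for l
  define pw :: "letter list \<Rightarrow> 'k jordan" where "pw ls = jproj (Poly_Mapping.single (Word ls) 1)" for ls
  define D where "D = rec_list 0 (\<lambda>l ls d. v l * pw ls + jproj (free_gen l) * d)"
  have D: "D [] = 0" "D (l # ls) = v l * pw ls + jproj (free_gen l) * D ls" for l ls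
    by (simp_all add: D_def)
  have pw: "pw [] = 1" "pw (l # ls) = jproj (free_gen l) * pw ls" for l ls
    by (simp_all add: pw_def single_Word_Cons jproj_mult jproj_1 flip: zero_word_def)
  have pw_append: "pw (ls @ ms) = pw ls * pw ms" for ls ms
    by (induction ls) (simp_all add: pw mult.assoc)
  have D_append: "D (ls @ ms) = D ls * pw ms + pw ls * D ms" for ls ms
    by (induction ls) (simp_all add: D pw pw_append algebra_simps)
  define F where "F w = D (letters w)" for w
  let ?E = "free_ext F"
  have single: "jproj (Poly_Mapping.single w c) = jscale c (pw (letters w))" for w c
  proof -
    have "Poly_Mapping.single w c = free_const c * Poly_Mapping.single w 1"
      by (simp add: free_const_def mult_single)
    then show ?thesis by (simp add: jproj_const pw_def)
  qed
  have leibniz: "?E (f * g) = ?E f * jproj g + jproj f * ?E g" for f g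
  proof (induction f rule: free_induct)
    case (single w c)
    show ?case
    proof (induction g rule: free_induct)
      case (single v d)
      show ?case
        by (simp add: mult_single free_ext_single F_def jscale_mult_left jscale_mult_right
            \<open>\<And>w c. jproj (Poly_Mapping.single w c) = _\<close> D_append jordan.scale_right_distrib mult.commute)
    qed (simp add: algebra_simps free_ext_add jproj_add)
  qed (simp add: algebra_simps free_ext_add jproj_add)
  have gen: "?E (free_gen LX) = a" "?E (free_gen LY) = b"
    by (simp_all add: free_gen_def free_ext_single F_def D pw v_def)
  have proj0: "jproj f = 0" if "f \<in> jordan_ideal" for f :: "'k free2"
    using that unfolding jproj_def zero_jordan.abs_eq jordan.abs_eq_iff by (simp add: jordan_rel_def)
  have "?E f = 0" if "f \<in> jordan_ideal" for f
    using that
  proof induction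
    case relator
    show ?case
      using assms
      by (simp add: jordan_relator_def free_ext_diff free_ext_add leibniz gen jproj_gen algebra_simps)
  qed (simp_all add: free_ext_0 free_ext_add leibniz proj0)
  then obtain h where h: "Vector_Spaces.linear jscale jscale h" "\<And>f. h (jproj f) = ?E f"
    using descend[of F] by blast
  have "h (u * v) = h u * v + u * h v" for u v
    using jproj_surj[of u] jproj_surj[of v] by (auto simp: h(2) leibniz simp flip: jproj_mult)
  moreover have "h jX = a" "h jY = b"
    using h(2)[of "free_gen LX"] h(2)[of "free_gen LY"] by (simp_all add: gen jproj_gen)
  ultimately show ?thesis using h(1) by (auto simp: derivation_def)
qed

lemma jscale_power: "jscale c u ^ n = jscale (c ^ n) (u ^ n)"
  by (induction n) (simp_all add: jscale_mult_left jscale_mult_right)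

lemma jeval_commute: "u * jeval g u = jeval g u * u"
  by (simp add: jeval_def sum_distrib_left sum_distrib_right jscale_mult_left jscale_mult_right
      power_commutes)

lemma jeval_altdef:
  assumes "degree g \<le> n"
  shows "jeval g u = (\<Sum>i\<le>n. jscale (coeff g i) (u ^ i))"
  unfolding jeval_def using assms
  by (intro sum.mono_neutral_left) (auto simp: coeff_eq_0)

lemma jeval_smult: "jeval (smult c g) u = jscale c (jeval g u)"
  unfolding jeval_altdef[OF degree_smult_le] by (simp add: jeval_def jordan.scale_sum_right)

lemma jeval_pcompose: "jeval (pcompose g [:0, c:]) u = jeval g (jscale c u)"
proof -
  have "degree (pcompose g [:0, c:]) \<le> degree g"
    by (simp add: degree_pcompose)
  from jeval_altdef[OF this] show ?thesis
    by (simp add: coeff_pcompose_linear jeval_def jscale_power mult.commute)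
qed

lemma alg_endo_jeval: "alg_endo \<rho> \<Longrightarrow> \<rho> (jeval g u) = jeval g (\<rho> u)"
  by (simp add: jeval_def alg_endoD)

lemma phi:
  shows alg_endo_phi: "alg_endo (phi \<gamma> g)"
    and phi_X: "phi \<gamma> g jX = jscale \<gamma> jX + jeval g jY"
    and phi_Y: "phi \<gamma> g jY = jscale \<gamma> jY"
proof -
  have "jscale \<gamma> jY * (jscale \<gamma> jX + jeval g jY)
      = (jscale \<gamma> jX + jeval g jY) * jscale \<gamma> jY + (jscale \<gamma> jY)\<^sup>2"
    unfolding distrib_left distrib_right jscale_mult_left jscale_mult_right jordan_relation
      jeval_commute power2_eq_square
    by (simp add: jordan.scale_right_distrib)
  from alg_endo_exists[OF this]
  have "\<exists>!\<rho>. alg_endo \<rho> \<and> \<rho> jX = jscale \<gamma> jX + jeval g jY \<and> \<rho> jY = jscale \<gamma> jY"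
    by (metis (no_types, lifting) alg_endo_eqI)
  from theI'[OF this, folded phi_def] show "alg_endo (phi \<gamma> g)"
    "phi \<gamma> g jX = jscale \<gamma> jX + jeval g jY" "phi \<gamma> g jY = jscale \<gamma> jY"
    by simp_all
qed

lemma alg_endo_id: "alg_endo (\<lambda>u. u)"
  by (simp add: alg_endo_def jordan.linear_ident)

lemma alg_endo_comp: "alg_endo \<rho> \<Longrightarrow> alg_endo \<sigma> \<Longrightarrow> alg_endo (\<lambda>u. \<rho> (\<sigma> u))"
  using Vector_Spaces.linear_compose[of jscale jscale \<sigma> jscale \<rho>]
  by (auto simp: alg_endo_def comp_def)

lemma phi_in_Aut:
  assumes "\<gamma> \<noteq> 0"
  shows "phi \<gamma> g \<in> Aut"
proof -
  define g' where "g' = smult (- inverse \<gamma>) (pcompose g [:0, inverse \<gamma>:])"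
  have g': "jeval g' u = - jscale (inverse \<gamma>) (jeval g (jscale (inverse \<gamma>) u))" for u
    by (simp add: g'_def jeval_smult jeval_pcompose del: smult_minus_left)
  have "(\<lambda>u. phi \<gamma> g (phi (inverse \<gamma>) g' u)) = (\<lambda>u. u)"
    by (rule alg_endo_eqI)
      (simp_all add: assms alg_endo_comp alg_endo_phi alg_endo_id phi_X phi_Y alg_endoD[OF alg_endo_phi]
        alg_endo_jeval g' jordan.scale_right_distrib
        jordan.scale_right_diff_distrib)
  moreover have "(\<lambda>u. phi (inverse \<gamma>) g' (phi \<gamma> g u)) = (\<lambda>u. u)"
    by (rule alg_endo_eqI)
      (simp_all add: assms alg_endo_comp alg_endo_phi alg_endo_id phi_X phi_Y alg_endoD[OF alg_endo_phi]
        alg_endo_jeval g' jordan.scale_right_distrib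
        jordan.scale_right_diff_distrib)
  ultimately have "bij (phi \<gamma> g)"
    by (intro o_bij) (auto simp: fun_eq_iff)
  then show ?thesis by (simp add: Aut_def alg_endo_phi)
qed

lemma delta:
  shows derivation_delta: "derivation (delta p)"
    and delta_X: "delta p jX = jeval p jY"
    and delta_Y: "delta p jY = 0"
proof -
  have "0 * jX + jY * jeval p jY = jeval p jY * jY + jX * 0 + 0 * jY + jY * 0"
    by (simp add: jeval_commute)
  from derivation_exists[OF this]
  have "\<exists>!\<delta>. derivation \<delta> \<and> \<delta> jY = 0 \<and> \<delta> jX = jeval p jY"
    by (metis (no_types, lifting) derivation_eqI)
  from theI'[OF this, folded delta_def]
  show "derivation (delta p)" "delta p jX = jeval p jY" "delta p jY = 0"
    by simp_all
qed

lemma derivation_funpow: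
  assumes "derivation \<delta>"
  shows "(\<delta> ^^ n) (u + v) = (\<delta> ^^ n) u + (\<delta> ^^ n) v"
    "(\<delta> ^^ n) (jscale c u) = jscale c ((\<delta> ^^ n) u)" "(\<delta> ^^ n) 0 = 0"
  by (induction n) (simp_all add: derivationD[OF assms])

lemma derivation_funpow_mult_eq_0:
  assumes "derivation \<delta>"
  shows "(\<delta> ^^ m) u = 0 \<Longrightarrow> (\<delta> ^^ n) v = 0 \<Longrightarrow> (\<delta> ^^ (m + n)) (u * v) = 0"
proof (induction "m + n" arbitrary: m n u v)
  case 0
  then show ?case by simp
next
  case (Suc k)
  show ?case
  proof (cases "m = 0 \<or> n = 0")
    case True
    then have "u * v = 0" using Suc.prems by auto
    then show ?thesis by (simp add: derivation_funpow[OF assms])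
  next
    case False
    then obtain m' n' where mn: "m = Suc m'" "n = Suc n'" by (metis not0_implies_Suc)
    have "(\<delta> ^^ (m' + n)) (\<delta> u * v) = 0"
      using Suc mn by (intro Suc.hyps(1)) (simp_all add: funpow_swap1)
    moreover have "(\<delta> ^^ (m + n')) (u * \<delta> v) = 0"
      using Suc mn by (intro Suc.hyps(1)) (simp_all add: funpow_swap1)
    ultimately show ?thesis
      by (simp add: mn funpow_Suc_right derivationD[OF assms] derivation_funpow[OF assms]
          del: funpow.simps)
  qed
qed

lemma locally_nilpotent_delta: "locally_nilpotent (delta p)"
  unfolding locally_nilpotent_def
proof
  note d = derivation_delta[of p]
  note fp = derivation_funpow[OF d]
  have more: "(delta p ^^ (n + m)) u = 0" if "(delta p ^^ m) u = 0" for m n u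
    using that by (simp add: funpow_add fp)
  have pow: "delta p (jY ^ i) = 0" for i
    by (induction i) (simp_all add: derivationD[OF d] delta_Y)
  fix u
  show "\<exists>n. (delta p ^^ n) u = 0"
  proof (induction u rule: jordan_induct)
    case one
    show ?case by (rule exI[of _ 1]) (simp add: derivationD[OF d])
  next
    case X
    show ?case
      by (rule exI[of _ 2]) (simp add: numeral_2_eq_2 delta_X jeval_def derivationD[OF d] pow)
  next
    case Y
    show ?case by (rule exI[of _ 1]) (simp add: delta_Y)
  next
    case (scale c u)
    then show ?case by (auto simp: fp)
  next
    case (add u v)
    then obtain m n where "(delta p ^^ m) u = 0" "(delta p ^^ n) v = 0" by blast
    then have "(delta p ^^ (m + n)) (u + v) = 0"
      using more[of m u n] more[of n v m] by (simp add: fp add.commute)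
    then show ?case ..
  next
    case (mult u v)
    then show ?case using derivation_funpow_mult_eq_0[OF d] by blast
  qed
qed

end

theory Submission
  imports Defs
begin

text \<open>
  The Jordanian plane acts on polynomials in \<open>x\<close> over \<open>k[y]\<close>, with \<open>y\<close> acting by multiplication and
  \<open>x\<close> by \<open>f x\<^sup>i \<mapsto> f x\<^sup>i\<^sup>+\<^sup>1 - y\<^sup>2 f' x\<^sup>i\<close>; acting on \<open>1\<close> gives the normal form with respect to the basis
  \<open>y\<^sup>j x\<^sup>i\<close>.  Modulo \<open>y\<close> the plane becomes the commutative domain \<open>k[x]\<close>, so any \<open>a, b\<close> with
  \<open>b a = a b + b\<^sup>2\<close> have \<open>b\<close> divisible by \<open>y\<close>.  Applied to an automorphism \<open>\<rho>\<close> and its inverse this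
  gives \<open>\<rho> y = y u\<close> with \<open>u\<close> a unit, that is, a scalar \<open>\<gamma>\<close> by degree in \<open>x\<close>.  The relation then says
  that \<open>\<rho> x - \<gamma> x\<close> commutes with \<open>y\<close>.  Since \<open>y u - u y = y (\<partial> u) y\<close> for the derivation
  \<open>\<partial> = d/dx\<close>, the centralizer of \<open>y\<close> is \<open>k[y]\<close> in characteristic zero, so \<open>\<rho>\<close> is some \<open>\<phi>\<close>.
  Commutation with \<open>\<delta>\<close> is finally compared on the generator \<open>x\<close>.
\<close>

section \<open>The normal form action\<close>

text \<open>This is \<open>f x - x f\<close> in the plane for \<open>f\<close> in
  \<open>k[y]\<close>.\<close>

definition euler2 :: "'k::field poly \<Rightarrow> 'k poly" where
  "euler2 f = [:0, 0, 1:] * pderiv f"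

lemma euler2_simps [simp]:
  "euler2 0 = 0" "euler2 (f + g) = euler2 f + euler2 g" "euler2 (smult c f) = smult c (euler2 f)"
  "euler2 (pCons 0 f) = pCons 0 (euler2 f) + pCons 0 (pCons 0 f)"
  by (simp_all add: euler2_def pderiv_add pderiv_smult pderiv_pCons algebra_simps)

text \<open>In \<open>'k poly poly\<close> the outer variable is \<open>x\<close> and the
  coefficients are polynomials in \<open>y\<close>; scalars of the field are the
  \<open>[:c:]\<close>.\<close>

definition opD :: "'k::field poly poly \<Rightarrow> 'k poly poly" where
  "opD P = map_poly euler2 P"

definition opX :: "'k::field poly poly \<Rightarrow> 'k poly poly" where
  "opX P = pCons 0 P - opD P"

definition opY :: "'k::field poly poly \<Rightarrow> 'k poly poly" where
  "opY P = smult [:0, 1:] P"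

lemma opD_pCons: "opD (pCons f P) = pCons (euler2 f) (opD P)"
  by (simp add: opD_def map_poly_pCons)

lemma opD_0 [simp]: "opD 0 = 0"
  by (simp add: opD_def)

lemma opD_add: "opD (P + Q) = opD P + opD Q"
  by (rule poly_eqI) (simp add: opD_def coeff_map_poly)

lemma opD_scale: "opD (smult [:c:] P) = smult [:c:] (opD P)"
  by (rule poly_eqI) (simp add: opD_def coeff_map_poly)

lemma opX_add: "opX (P + Q) = opX P + opX Q"
  using add_pCons[of 0 P 0 Q] by (simp add: opX_def opD_add)

lemma opX_scale: "opX (smult [:c:] P) = smult [:c:] (opX P)"
  by (simp add: opX_def opD_scale smult_diff_right)

lemma opY_add: "opY (P + Q) = opY P + opY Q"
  by (simp add: opY_def smult_add_right)

lemma opY_scale: "opY (smult [:c:] P) = smult [:c:] (opY P)"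
  by (simp add: opY_def mult.commute)

text \<open>The product rule for \<open>y f\<close> contributes the extra \<open>- y^2 f\<close> in
  \<open>opX (opY P)\<close>, which the last summand restores.\<close>

lemma op_relation: "opY (opX P) = opX (opY P) + opY (opY P)"
  by (rule poly_eqI) (simp add: opX_def opY_def opD_def coeff_map_poly coeff_pCons split: nat.split)

section \<open>Action of the free algebra and its descent to the plane\<close>

definition letter_op :: "letter \<Rightarrow> 'k::field poly poly \<Rightarrow> 'k poly poly" where
  "letter_op l = (case l of LX \<Rightarrow> opX | LY \<Rightarrow> opY)"

definition word_op :: "word \<Rightarrow> 'k::field poly poly \<Rightarrow> 'k poly poly" where
  "word_op w = foldr letter_op (letters w)"

lemma word_op_plus: "word_op (v + w) P = word_op v (word_op w P)"
  by (simp add: word_op_def)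

lemma word_op_linear:
  "word_op w (P + Q) = word_op w P + word_op w Q"
  "word_op w (smult [:c:] P) = smult [:c:] (word_op w P)"
proof -
  have "foldr letter_op ls (P + Q) = foldr letter_op ls P + foldr letter_op ls Q"
    "foldr letter_op ls (smult [:c:] P) = smult [:c:] (foldr letter_op ls P)" for ls
    by (induction ls)
      (simp_all add: letter_op_def opX_add opY_add opX_scale opY_scale split: letter.split)
  then show "word_op w (P + Q) = word_op w P + word_op w Q"
    "word_op w (smult [:c:] P) = smult [:c:] (word_op w P)"
    by (simp_all add: word_op_def)
qed

definition free_act :: "'k::field free2 \<Rightarrow> 'k poly poly \<Rightarrow> 'k poly poly" where
  "free_act f P = (\<Sum>w\<in>Poly_Mapping.keys f. smult [:Poly_Mapping.lookup f w:] (word_op w P))"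

lemma free_act_single: "free_act (Poly_Mapping.single w c) P = smult [:c:] (word_op w P)"
  by (simp add: free_act_def)

lemma free_act_add: "free_act (f + g) P = free_act f P + free_act g P"
  unfolding free_act_def
  by (rule setsum_keys_plus_distrib) (simp_all flip: smult_add_left)

lemma free_act_linear:
  "free_act f (P + Q) = free_act f P + free_act f Q"
  "free_act f (smult [:c:] P) = smult [:c:] (free_act f P)"
  by (induction f rule: free_induct)
    (simp_all add: free_act_single free_act_add word_op_linear smult_add_right mult.commute algebra_simps)

lemma free_act_mult: "free_act (f * g) P = free_act f (free_act g P)"
proof (induction f rule: free_induct)
  case (single w c)
  show ?case
  proof (induction g rule: free_induct)
    case (single v d)
    show ?case by (simp add: mult_single free_act_single word_op_plus word_op_linear mult.commute)
  qed (simp add: distrib_left free_act_add free_act_linear)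
qed (simp add: distrib_right free_act_add)

lemma free_act_0 [simp]: "free_act 0 P = 0"
  by (simp add: free_act_def)

lemma free_act_0_right [simp]: "free_act f 0 = 0"
  using free_act_linear(2)[of f 0 0] by simp

lemma free_act_diff: "free_act (f - g) P = free_act f P - free_act g P"
  using free_act_add[of "f - g" g P] by simp

lemma free_act_1: "free_act 1 P = P"
  unfolding single_one[symmetric] free_act_single by (simp add: word_op_def flip: one_pCons)

lemma free_act_gen: "free_act (free_gen l) P = letter_op l P"
  by (simp add: free_gen_def free_act_single word_op_def flip: one_pCons)

lemma free_act_jordan_ideal: "f \<in> jordan_ideal \<Longrightarrow> free_act f P = 0"
proof (induction arbitrary: P rule: jordan_ideal.induct)
  case relator
  show ?case
    by (simp add: jordan_relator_def free_act_diff free_act_add free_act_mult free_act_gen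
        letter_op_def op_relation)
qed (simp_all add: free_act_add free_act_mult)

lift_definition act :: "'k::field jordan \<Rightarrow> 'k poly poly \<Rightarrow> 'k poly poly" is free_act
  by (simp add: jordan_rel_def fun_eq_iff)
    (metis free_act_jordan_ideal free_act_diff eq_iff_diff_eq_0)

lemma act_add: "act (u + v) P = act u P + act v P"
  by transfer (rule free_act_add)

lemma act_mult: "act (u * v) P = act u (act v P)"
  by transfer (rule free_act_mult)

lemma act_1 [simp]: "act 1 P = P"
  by transfer (rule free_act_1)

lemma act_0 [simp]: "act 0 P = 0"
  by transfer (rule free_act_0)

lemma act_0_right [simp]: "act u 0 = 0"
  by transfer (rule free_act_0_right)

lemma act_X [simp]: "act jX P = opX P"
  by transfer (simp add: free_act_gen letter_op_def)

lemma act_Y [simp]: "act jY P = opY P"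
  by transfer (simp add: free_act_gen letter_op_def)

lemma act_scale: "act (jscale c u) P = smult [:c:] (act u P)"
  by transfer (simp add: free_act_mult free_const_def free_act_single word_op_def)

section \<open>Normal forms\<close>

lemma jeval_0 [simp]: "jeval 0 u = 0"
  by (simp add: jeval_def)

lemma jeval_pCons: "jeval (pCons c f) u = jscale c 1 + u * jeval f u"
proof -
  have "jeval (pCons c f) u = (\<Sum>i\<le>Suc (degree f). jscale (coeff (pCons c f) i) (u ^ i))"
    by (rule jeval_altdef) (rule degree_pCons_le)
  also have "\<dots> = jscale c 1 + (\<Sum>i\<le>degree f. jscale (coeff f i) (u * u ^ i))"
    by (subst sum.atMost_Suc_shift) simp
  finally show ?thesis
    by (simp add: jeval_def sum_distrib_left jscale_mult_right)
qed

lemma jeval_add: "jeval (f + g) u = jeval f u + jeval g u"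
proof (induction f arbitrary: g)
  case (pCons c f)
  show ?case
    by (cases g) (simp add: jeval_pCons pCons.IH jordan.scale_left_distrib distrib_left)
qed simp

lemma act_jeval_Y: "act (jeval f jY) P = smult f P"
proof (induction f)
  case (pCons c f)
  have "smult (pCons c f) P = smult [:c:] P + smult [:0, 1:] (smult f P)"
    unfolding smult_smult smult_add_left[symmetric] by simp
  then show ?case by (simp add: jeval_pCons act_add act_mult act_scale pCons.IH opY_def)
qed simp

text \<open>The straightening rule that moves \<open>x\<close> to the right of a coefficient,
  obtained by moving it past one \<open>y\<close> at a time.\<close>

lemma jX_jeval_Y: "jX * jeval f jY = jeval f jY * jX - jeval (euler2 f) (jY :: 'k::field jordan)"
proof (induction f)
  case (pCons c f)
  have "euler2 (pCons c f) = pCons 0 (euler2 f) + pCons 0 (pCons 0 f)"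
    by (simp add: euler2_def pderiv_pCons)
  moreover have "jX * jY = jY * jX - jY * (jY :: 'k jordan)"
    by (simp add: jordan_relation power2_eq_square)
  then have "jX * (jY * jeval f jY) = jY * (jX * jeval f jY) - jY * (jY * jeval f jY)"
    by (simp add: left_diff_distrib flip: mult.assoc)
  ultimately show ?case
    by (simp add: jeval_pCons jeval_add jscale_mult_left jscale_mult_right pCons.IH algebra_simps)
qed simp

text \<open>Horner scheme for the sum of the \<open>f_i(y) x^i\<close>, with coefficients on the
  left.\<close>

definition nform :: "'k::field poly poly \<Rightarrow> 'k jordan" where
  "nform P = fold_coeffs (\<lambda>f u. jeval f jY + u * jX) P 0"

lemma nform_0 [simp]: "nform 0 = 0"
  by (simp add: nform_def)

lemma nform_pCons: "nform (pCons f P) = jeval f jY + nform P * jX"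
  by (cases "f = 0 \<and> P = 0") (auto simp: nform_def)

lemma nform_add: "nform (P + Q) = nform P + nform Q"
proof (induction P arbitrary: Q)
  case (pCons f P)
  show ?case
    by (cases Q) (simp add: nform_pCons pCons.IH jeval_add distrib_right)
qed simp

lemma nform_diff: "nform (P - Q) = nform P - nform Q"
  using nform_add[of "P - Q" Q] by simp

lemma nform_opX: "nform (opX P) = jX * nform P"
proof -
  have "jX * nform P = nform P * jX - nform (opD P)"
  proof (induction P)
    case (pCons f P)
    have "jX * nform (pCons f P) = jX * jeval f jY + jX * nform P * jX"
      by (simp add: nform_pCons distrib_left mult.assoc)
    also have "\<dots> = nform (pCons f P) * jX - nform (opD (pCons f P))"
      by (simp add: pCons.IH jX_jeval_Y nform_pCons opD_pCons left_diff_distrib distrib_right)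
    finally show ?case .
  qed simp
  then show ?thesis by (simp add: opX_def nform_diff nform_pCons)
qed

lemma nform_opY: "nform (opY P) = jY * nform P"
  by (induction P) (simp_all add: opY_def nform_pCons jeval_pCons algebra_simps)

lemma nform_scale: "nform (smult [:c:] P) = jscale c (nform P)"
  by (induction P)
    (simp_all add: nform_pCons jeval_smult jordan.scale_right_distrib jscale_mult_left)

text \<open>\<open>nform\<close> turns the action into left multiplication. At \<open>P = 1\<close>
  this writes every \<open>u\<close> as a normal form.\<close>

lemma nform_act: "nform (act u P) = u * nform P"
  by (induction u arbitrary: P rule: jordan_induct)
    (simp_all add: nform_opX nform_opY nform_scale nform_add act_add act_mult act_scale
      jscale_mult_left algebra_simps)

lemma nform_1 [simp]: "nform 1 = 1"
  by (simp add: one_pCons nform_pCons jeval_pCons)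

lemma nform_act_1 [simp]: "nform (act u 1) = u"
  by (simp add: nform_act)

section \<open>Degree in \<open>x\<close>, zero divisors and units\<close>

lemma degree_opX: "P \<noteq> 0 \<Longrightarrow> opX P \<noteq> 0 \<and> degree (opX P) = Suc (degree P)"
proof -
  assume P: "P \<noteq> 0"
  have "degree (opD P) < degree (pCons 0 P)"
    using P map_poly_degree_leq[of euler2 P] by (simp add: opD_def)
  then have "degree (opX P) = Suc (degree P)"
    using P degree_add_eq_left[of "- opD P" "pCons 0 P"] by (simp add: opX_def)
  then show ?thesis by auto
qed

text \<open>\<open>opX\<close> raises the degree by one and \<open>k[y]\<close> is a domain, so
  degrees add. \<open>P\<close> is arbitrary because the Horner step replaces it by
  \<open>opX P\<close>.\<close>

lemma act_nform_nonzero: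
  "Q \<noteq> 0 \<Longrightarrow> P \<noteq> 0 \<Longrightarrow> act (nform Q) P \<noteq> 0 \<and> degree (act (nform Q) P) = degree Q + degree P"
proof (induction Q arbitrary: P)
  case (pCons f Q)
  have *: "act (nform (pCons f Q)) P = smult f P + act (nform Q) (opX P)"
    by (simp add: nform_pCons act_add act_jeval_Y act_mult)
  show ?case
  proof (cases "Q = 0")
    case True
    with pCons show ?thesis unfolding * by simp
  next
    case False
    with pCons degree_opX[of P]
    have "degree (act (nform Q) (opX P)) = degree (pCons f Q) + degree P"
      by simp
    moreover from this False have "degree (smult f P) < degree (act (nform Q) (opX P))"
      by simp
    ultimately have "degree (act (nform (pCons f Q)) P) = degree (pCons f Q) + degree P"
      unfolding * by (metis degree_add_eq_right)
    with False show ?thesis by auto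
  qed
qed simp

text \<open>Uniqueness of normal forms: a nonzero \<open>P\<close> with \<open>nform P = 0\<close>
  would act on \<open>1\<close> as zero, against the degree count.\<close>

lemma act_nform_1: "act (nform P) 1 = P"
proof -
  have *: "nform P = 0 \<Longrightarrow> P = 0" for P :: "'a poly poly"
    using act_nform_nonzero[of P 1] by auto
  have "nform (act (nform P) 1 - P) = 0" by (simp add: nform_diff)
  from *[OF this] show ?thesis by simp
qed

lemma jordan_mult_eq_0_iff: "u * v = 0 \<longleftrightarrow> u = 0 \<or> (v :: 'k::field jordan) = 0"
proof
  assume "u * v = 0"
  then have "act (nform (act u 1)) (act v 1) = 0"
    by (simp flip: act_mult)
  then have "act u 1 = 0 \<or> act v 1 = 0"
    using act_nform_nonzero by blast
  then show "u = 0 \<or> v = 0"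
    by (metis nform_0 nform_act_1)
qed auto

lemma jY_nonzero: "jY \<noteq> (0 :: 'k::field jordan)"
  proof
  assume "jY = (0 :: 'k jordan)"
  then have "opY (1 :: 'k poly poly) = 0"
    by (metis act_Y act_0)
  then show False by (simp add: opY_def)
qed

lemma jeval_Y_inject: "jeval f jY = jeval g jY \<longleftrightarrow> f = g"
proof
  assume "jeval f jY = jeval g jY"
  then have "smult f 1 = smult g 1"
    by (metis act_jeval_Y)
  then show "f = g" by (simp add: one_pCons)
qed simp

text \<open>Additivity of the degree in \<open>x\<close> leaves a unit of \<open>k[y]\<close>, which
  is constant.\<close>

lemma jordan_unit_scalar:
  assumes "u * v = (1 :: 'k::field jordan)"
  obtains c where "u = jscale c 1"
proof -
  define P Q where "P = act u 1" and "Q = act v 1"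
  have uv: "act (nform P) Q = 1"
    using assms by (simp add: P_def Q_def flip: act_mult)
  then have "P \<noteq> 0" "Q \<noteq> 0" by auto
  with act_nform_nonzero[of P Q] uv have "degree P = 0" "degree Q = 0" by auto
  then obtain f g where fg: "P = [:f:]" "Q = [:g:]" by (metis degree_eq_zeroE)
  with uv have "f * g = 1"
    by (simp add: nform_pCons act_jeval_Y one_pCons)
  then have "degree f = 0"
    by (metis dvdI is_unit_iff_degree dvd_0_left_iff zero_neq_one)
  then obtain c where "f = [:c:]" by (metis degree_eq_zeroE)
  then have "nform P = jscale c 1"
    by (simp add: fg nform_pCons jeval_pCons)
  then show thesis using that by (simp add: P_def)
qed

section \<open>Automorphisms\<close>

text \<open>Setting \<open>y = 0\<close> turns \<open>opX\<close> into multiplication by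
  \<open>x\<close> and \<open>opY\<close> into zero; \<open>q\<close> is the image of
  \<open>u\<close> in \<open>k[x]\<close>.\<close>

lemma act_mod_Y:
  fixes u :: "'k::field jordan"
  shows "\<exists>q. \<forall>P. map_poly (\<lambda>f. coeff f 0) (act u P) = q * map_poly (\<lambda>f. coeff f 0) P"
proof -
  define e :: "'k poly poly \<Rightarrow> 'k poly" where "e = map_poly (\<lambda>f. coeff f 0)"
  have e: "e (P + Q) = e P + e Q" "e (smult [:c:] P) = smult c (e P)"
    "e (opX P) = pCons 0 (e P)" "e (opY P) = 0" for P Q c
    by (rule poly_eqI, simp add: e_def coeff_map_poly opX_def opD_def opY_def euler2_def
        coeff_pCons split: nat.split)+
  have "\<exists>q. \<forall>P. e (act u P) = q * e P"
  proof (induction u rule: jordan_induct)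
    case one
    show ?case by (rule exI[of _ 1]) simp
  next
    case X
    show ?case by (rule exI[of _ "[:0, 1:]"]) (simp add: e)
  next
    case Y
    show ?case by (rule exI[of _ 0]) (simp add: e)
  next
    case (scale c u)
    then show ?case by (metis act_scale e(2) mult_smult_left)
  next
    case (add u v)
    then show ?case by (metis act_add e(1) distrib_right)
  next
    case (mult u v)
    then show ?case by (metis act_mult mult.assoc)
  qed
  then show ?thesis by (simp add: e_def)
qed

text \<open>In \<open>k[x]\<close> the commutators vanish, so the relation leaves
  \<open>q^2 = 0\<close> for the image \<open>q\<close> of \<open>b\<close>.\<close>

lemma jordan_pair_dvd:
  fixes a b :: "'k::field jordan"
  assumes "b * a = a * b + b ^ 2"
  obtains v where "b = jY * v"
proof -
  define e :: "'k poly poly \<Rightarrow> 'k poly" where "e = map_poly (\<lambda>f. coeff f 0)"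
  have e_add: "e (P + Q) = e P + e Q" for P Q
    by (rule poly_eqI) (simp add: e_def coeff_map_poly)
  obtain q r where q: "\<And>P. e (act b P) = q * e P" and r: "\<And>P. e (act a P) = r * e P"
    using act_mod_Y[of a] act_mod_Y[of b] unfolding e_def by metis
  have "act b (act a 1) = act a (act b 1) + act b (act b 1)"
    using assms by (simp add: power2_eq_square flip: act_mult act_add)
  from arg_cong[OF this, of e] have "q * q * e 1 = 0"
    by (simp add: e_add q r algebra_simps)
  moreover have "e 1 = 1"
    by (simp add: e_def)
  ultimately have e0: "e (act b 1) = 0"
    using q[of 1] by simp
  \<comment> \<open>Every coefficient has zero constant term, so shifting it by one divides it by
    \<open>y\<close>.\<close>
  define P where "P = map_poly (\<lambda>f. poly_shift 1 f) (act b 1)"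
  have "act b 1 = opY P"
  proof (rule poly_eqI)
    fix n
    have "coeff (coeff (act b 1) n) 0 = 0"
      using arg_cong[OF e0, of "\<lambda>p. coeff p n"] by (simp add: e_def coeff_map_poly)
    then show "coeff (act b 1) n = coeff (opY P) n"
      by (intro poly_eqI)
        (simp add: P_def opY_def coeff_map_poly coeff_poly_shift coeff_pCons split: nat.split)
  qed
  then have "b = jY * nform P"
    by (metis nform_act_1 nform_opY)
  then show thesis by (rule that)
qed

lemma centralizer_Y:
  fixes u :: "'k::field_char_0 jordan"
  assumes "jY * u = u * jY"
  obtains g where "u = jeval g jY"
proof -
  \<comment> \<open>Compatibility of the values \<open>1\<close> at \<open>x\<close> and
    \<open>0\<close> at \<open>y\<close> with the relation; \<open>d\<close> is
    \<open>d/dx\<close>.\<close>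
  have "0 * jX + jY * 1 = 1 * jY + jX * 0 + 0 * jY + jY * (0 :: 'k jordan)" by simp
  from derivation_exists[OF this] obtain d :: "'k jordan \<Rightarrow> 'k jordan"
    where d: "derivation d" "d jX = 1" "d jY = 0" by blast
  note D = derivationD[OF d(1)]
  have comm: "jY * v = v * jY + jY * d v * jY" for v
  proof (induction v rule: jordan_induct)
    case (mult v w)
    have "jY * (v * w) = v * (jY * w) + jY * d v * (jY * w)"
      by (subst mult.assoc[symmetric], subst mult.IH(1)) (simp add: algebra_simps)
    also have "\<dots> = v * w * jY + (v * jY + jY * d v * jY) * d w * jY + jY * d v * w * jY"
      by (subst (1 2) mult.IH(2)) (simp add: algebra_simps)
    \<comment> \<open>Folding the bracket back absorbs the second-order term
      \<open>y (d v) y (d w) y\<close>.\<close>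
    also have "v * jY + jY * d v * jY = jY * v"
      using mult.IH(1) by simp
    finally show ?case by (simp add: D algebra_simps)
  qed (simp_all add: D d jordan_relation power2_eq_square jscale_mult_left jscale_mult_right
      algebra_simps flip: jordan.scale_right_distrib)
  have "jY * d u * jY = 0"
    using comm[of u] assms by simp
  then have du: "d u = 0"
    by (simp add: jordan_mult_eq_0_iff jY_nonzero)
  have dY: "d (jeval f jY) = 0" for f
    by (induction f) (simp_all add: jeval_pCons D d)
  \<comment> \<open>On normal forms \<open>d\<close> differentiates in the outer variable, so
    characteristic zero makes its kernel the coefficients \<open>k[y]\<close>.\<close>
  have "d (nform P) = nform (pderiv P)" for P
    by (induction P) (simp_all add: nform_pCons pderiv_pCons nform_add D d dY)
  from this[of "act u 1"] have "nform (pderiv (act u 1)) = 0"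
    by (simp add: du)
  then have "pderiv (act u 1) = 0"
    by (metis act_0 act_nform_1)
  then have "degree (act u 1) = 0"
    by (simp add: pderiv_eq_0_iff)
  then obtain g where "act u 1 = [:g:]" by (metis degree_eq_zeroE)
  then have "nform (act u 1) = jeval g jY"
    by (simp only: nform_pCons nform_0) simp
  then show thesis using that by simp
qed

lemma Aut_cases:
  fixes \<rho> :: "'k::field_char_0 jordan \<Rightarrow> 'k jordan"
  assumes "\<rho> \<in> Aut"
  obtains \<gamma> g where "\<gamma> \<noteq> 0" "\<rho> = phi \<gamma> g"
proof -
  have endo: "alg_endo \<rho>" and bij: "bij \<rho>"
    using assms by (auto simp: Aut_def)
  note R = alg_endoD[OF endo]
  have rel: "\<rho> jY * \<rho> jX = \<rho> jX * \<rho> jY + (\<rho> jY)\<^sup>2"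
    using arg_cong[OF jordan_relation, of \<rho>] by (simp add: R)
  then obtain u where u: "\<rho> jY = jY * u" by (rule jordan_pair_dvd)
  \<comment> \<open>The preimages of the generators satisfy the same relation by injectivity, so
    \<open>b\<close> is divisible by \<open>y\<close> too.\<close>
  obtain a b where ab: "\<rho> a = jX" "\<rho> b = jY"
    using bij by (metis bij_pointE)
  have "\<rho> (b * a) = \<rho> (a * b + b\<^sup>2)"
    by (simp add: R ab jordan_relation)
  then have "b * a = a * b + b\<^sup>2"
    using bij by (simp add: bij_def inj_eq)
  then obtain v where "b = jY * v" by (rule jordan_pair_dvd)
  \<comment> \<open>Apply \<open>\<rho>\<close> to \<open>b = y v\<close>: this gives
    \<open>y = y u (\<rho> v)\<close>, and \<open>y\<close> cancels.\<close>
  then have "jY * (u * \<rho> v - 1) = 0"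
    using ab(2) by (simp add: R u algebra_simps)
  then have "u * \<rho> v = 1"
    by (simp add: jordan_mult_eq_0_iff jY_nonzero)
  then obtain \<gamma> where "u = jscale \<gamma> 1" by (rule jordan_unit_scalar)
  then have Y: "\<rho> jY = jscale \<gamma> jY" by (simp add: u jscale_mult_right)
  have \<gamma>: "\<gamma> \<noteq> 0"
    using \<open>u * \<rho> v = 1\<close> \<open>u = jscale \<gamma> 1\<close> by auto
  have "jscale \<gamma> (jY * \<rho> jX) = jscale \<gamma> (\<rho> jX * jY + jscale \<gamma> (jY * jY))"
    using rel
    by (simp add: Y jscale_mult_left jscale_mult_right power2_eq_square jordan.scale_right_distrib)
  then have "jY * \<rho> jX = \<rho> jX * jY + jscale \<gamma> (jY * jY)"
    using \<gamma> by simp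
  \<comment> \<open>The term \<open>\<gamma> y^2\<close> is also the commutator of \<open>y\<close>
    with \<open>\<gamma> x\<close>, so it drops out.\<close>
  then have "jY * (\<rho> jX - jscale \<gamma> jX) = (\<rho> jX - jscale \<gamma> jX) * jY"
    by (simp add: left_diff_distrib right_diff_distrib jscale_mult_left jscale_mult_right
        jordan_relation power2_eq_square jordan.scale_right_distrib)
  then obtain g where "\<rho> jX - jscale \<gamma> jX = jeval g jY" by (rule centralizer_Y)
  then have "\<rho> = phi \<gamma> g"
    by (intro alg_endo_eqI endo alg_endo_phi) (simp_all add: phi_X phi_Y Y algebra_simps)
  with \<gamma> show thesis by (rule that)
qed

section \<open>Commutation with \<open>delta\<close>\<close>

lemma phi_delta_commute_iff:
  fixes p :: "'k::field poly"
  shows "phi \<gamma> g \<circ> delta p = delta p \<circ> phi \<gamma> g \<longleftrightarrow> pcompose p [:0, \<gamma>:] = smult \<gamma> p"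
    (is "?comm \<longleftrightarrow> ?eq")
proof -
  note R = alg_endoD[OF alg_endo_phi[of \<gamma> g]]
  note D = derivationD[OF derivation_delta[of p]]
  have dY: "delta p (jeval f jY) = 0" for f
    by (induction f) (simp_all add: jeval_pCons D delta_Y)
  \<comment> \<open>On \<open>x\<close> the sides are \<open>p(\<gamma> y)\<close> and
    \<open>\<gamma> p(y)\<close>; \<open>g\<close> disappears because \<open>delta p\<close> kills
    \<open>k[y]\<close>.\<close>
  have *: "phi \<gamma> g (delta p jX) = delta p (phi \<gamma> g jX) \<longleftrightarrow> ?eq"
    by (simp add: delta_X phi_X phi_Y alg_endo_jeval[OF alg_endo_phi] D dY jeval_Y_inject
        flip: jeval_pcompose jeval_smult)
  show ?thesis
  proof
    assume ?comm
    then show ?eq using * by (simp add: fun_eq_iff)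
  next
    assume ?eq
    \<comment> \<open>Both composites are linear and obey the same Leibniz rule twisted by
      \<open>phi\<close>, so agreement on generators spreads.\<close>
    have "phi \<gamma> g (delta p u) = delta p (phi \<gamma> g u)" for u
      by (induction u rule: jordan_induct)
        (simp_all add: R D * \<open>?eq\<close> phi_Y delta_Y)
    then show ?comm by auto
  qed
qed

theorem proposition20:
  fixes p :: "'k::{alg_closed_field, field_char_0} poly"
  shows "isotropy (delta p) =
    {phi \<gamma> g | \<gamma> g. \<gamma> \<noteq> 0 \<and> phi \<gamma> g \<in> Aut \<and> pcompose p [:0, \<gamma>:] = smult \<gamma> p}"
proof -
  have "isotropy (delta p) = {phi \<gamma> g | \<gamma> g. \<gamma> \<noteq> 0 \<and> phi \<gamma> g \<circ> delta p = delta p \<circ> phi \<gamma> g}"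
    unfolding isotropy_def using Aut_cases phi_in_Aut by blast
  then show ?thesis
    using phi_in_Aut unfolding phi_delta_commute_iff by blast
qed

end
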